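(* Let $k$ be a positive integer and let $u : \mathbb{Z}^k \to \mathbb{Z}$ be a function. Let $\mathcal{B}$ be a subset of $\mathbb{Z}^k$ admitting a minimal complement $M$ in $\mathbb{Z}^k$. Then $u$ admits a moderation, and for every moderation $v$ of $u$, the subset $$M_v := \{(x, v(x)) : x \in M\}$$ of $\mathbb{Z}^{k+1}$ is a minimal complement in $\mathbb{Z}^{k+1}$ of every subset $X \subseteq \mathbb{Z}^{k+1}$ satisfying $$\mathcal{B} \times \mathbb{Z} \subseteq X \subseteq (\mathcal{B} \times \mathbb{Z}) \cup \bigcup_{x \in \mathbb{Z}^k \setminus \mathcal{B}} \big(\{x\} \times \{n \in \mathbb{Z} : n < u(x)\}\big).$$
   Context: For an abelian group $G$ and nonempty subsets $W, W' \subseteq G$, $W'$ is a complement of $W$ in $G$ if $W + W' = G$; it is a minimal complement if moreover $W + (W' \setminus \{w'\}) \neq G$ for every $w' \in W'$. Given a function $u : \mathbb{Z}^k \to \mathbb{Z}$, a function $v : \mathbb{Z}^k \to \mathbb{Z}$ is called a moderation of $u$ if for each $x_0 \in \mathbb{Z}^k$ the function $x \mapsto u(x) + v(x_0 - x)$ on $\mathbb{Z}^k$ is bounded above. *)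

theory Defs
  imports "HOL-Analysis.Finite_Cartesian_Product" "HOL-Library.Set_Algebras" "HOL-Library.Product_Plus"
begin

text \<open>The ambient abelian group is a whole type, and \<open>W + W'\<close> is the elementwise sum of sets
  from \<^theory>\<open>HOL-Library.Set_Algebras\<close>. The second argument is the complement of the first.
  \<open>\<int>\<^sup>k\<close> is \<^typ>\<open>int ^ 'k\<close> with \<open>k = CARD('k) \<ge> 1\<close>, and \<open>\<int>\<^sup>k\<^sup>+\<^sup>1\<close> is the product group
  \<^typ>\<open>(int ^ 'k) \<times> int\<close>.\<close>

definition is_complement :: "'a::ab_group_add set \<Rightarrow> 'a set \<Rightarrow> bool" where
  "is_complement W W' \<longleftrightarrow> W \<noteq> {} \<and> W' \<noteq> {} \<and> W + W' = UNIV"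

definition is_minimal_complement :: "'a::ab_group_add set \<Rightarrow> 'a set \<Rightarrow> bool" where
  "is_minimal_complement W W' \<longleftrightarrow>
     is_complement W W' \<and> (\<forall>w'\<in>W'. W + (W' - {w'}) \<noteq> UNIV)"

definition is_moderation :: "(int ^ 'k \<Rightarrow> int) \<Rightarrow> (int ^ 'k \<Rightarrow> int) \<Rightarrow> bool" where
  "is_moderation u v \<longleftrightarrow> (\<forall>x\<^sub>0. bdd_above (range (\<lambda>x. u x + v (x\<^sub>0 - x))))"

end

theory Submission
  imports Defs
begin

text \<open>If \<open>y\<close> is missed by \<open>B + (M - {w})\<close>, every representation of \<open>(y, n)\<close> by
  \<open>X\<close> and \<open>M\<^sub>v - {(w, v w)}\<close> uses a point of \<open>X\<close> outside \<open>B \<times> \<int>\<close>, so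
  \<open>n < u x + v (y - x)\<close> for some \<open>x\<close>; the moderation property bounds the right-hand side, and
  large \<open>n\<close> are missed. A moderation exists because \<open>\<int>\<^sup>k\<close> is countable: it suffices that for
  each \<open>z\<close> the inequality \<open>v y \<le> - u (z - y)\<close> holds for all but finitely many \<open>y\<close>,
  which a diagonal sum over an enumeration achieves.\<close>

lemma ex_moderation:
  fixes u :: "int ^ 'k::finite \<Rightarrow> int"
  shows "\<exists>v. is_moderation u v"
proof
  define v where "v y = - (\<Sum>i\<le>to_nat y. \<bar>u (from_nat i - y)\<bar>)" for y :: "int ^ 'k"
  show "is_moderation u v"
    unfolding is_moderation_def
  proof
    fix z :: "int ^ 'k"
    let ?f = "\<lambda>x. u x + v (z - x)"
    \<comment> \<open>\<open>F\<close> collects the \<open>x\<close> for which \<open>z - x\<close>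
      is enumerated before \<open>z\<close>; otherwise the sum in \<open>v (z - x)\<close> has the
      index \<open>to_nat z\<close>, whose summand is \<open>\<bar>u x\<bar>\<close>.\<close>
    define F where "F = (\<lambda>y. z - y) ` (to_nat -` {..<to_nat z})"
    have "finite F"
      unfolding F_def by (intro finite_imageI finite_vimageI) auto
    have "?f x \<le> 0" if "x \<notin> F" for x
    proof -
      have "to_nat z \<le> to_nat (z - x)"
        using that imageI[of "z - x" "to_nat -` {..<to_nat z}" "\<lambda>y. z - y"]
        by (auto simp: F_def)
      then have "\<bar>u (from_nat (to_nat z) - (z - x))\<bar>
          \<le> (\<Sum>i\<le>to_nat (z - x). \<bar>u (from_nat i - (z - x))\<bar>)"
        by (intro member_le_sum) auto
      then show ?thesis
        by (simp add: v_def)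
    qed
    \<comment> \<open>A sum of absolute values, unlike a maximum, also makes sense for empty
      \<open>F\<close>, and being nonnegative it serves off \<open>F\<close> too.\<close>
    moreover have "?f x \<le> (\<Sum>x\<in>F. \<bar>?f x\<bar>)" if "x \<in> F" for x
      using member_le_sum[of x F "\<lambda>x. \<bar>?f x\<bar>"] that \<open>finite F\<close> by auto
    moreover have "0 \<le> (\<Sum>x\<in>F. \<bar>?f x\<bar>)"
      by (simp add: sum_nonneg)
    ultimately have "?f x \<le> (\<Sum>x\<in>F. \<bar>?f x\<bar>)" for x
      by (meson order_trans)
    then show "bdd_above (range ?f)"
      by (rule bdd_aboveI2)
  qed
qed

text \<open>Over \<open>B\<close> the fibres of \<open>X\<close> are full, so the
  \<open>X\<close>-summand absorbs the shift \<open>v m\<close>.\<close>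

lemma graph_is_complement:
  fixes v :: "'a::ab_group_add \<Rightarrow> 'b::ab_group_add"
  assumes "is_complement B M" and "B \<times> UNIV \<subseteq> X"
  shows "is_complement X {(x, v x) | x. x \<in> M}"
proof -
  have "p \<in> X + {(x, v x) | x. x \<in> M}" for p
  proof -
    obtain b m where "b \<in> B" "m \<in> M" "fst p = b + m"
      using assms(1) by (metis UNIV_I is_complement_def set_plus_elim)
    then have "p = (b, snd p - v m) + (m, v m)" "(b, snd p - v m) \<in> X"
      using assms(2) by (auto simp: prod_eq_iff)
    with \<open>m \<in> M\<close> show ?thesis
      by (metis (mono_tags, lifting) mem_Collect_eq set_plus_intro)
  qed
  then show ?thesis
    using assms by (fastforce simp: is_complement_def)
qed

lemma graph_is_minimal_complement:
  fixes u v :: "int ^ 'k::finite \<Rightarrow> int"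
  assumes BM: "is_minimal_complement B M" and v: "is_moderation u v"
    and BX: "B \<times> UNIV \<subseteq> X"
    and X: "X \<subseteq> (B \<times> UNIV) \<union> (\<Union>x\<in>UNIV - B. {x} \<times> {n. n < u x})"
  shows "is_minimal_complement X {(x, v x) | x. x \<in> M}"
  unfolding is_minimal_complement_def
proof (intro conjI ballI)
  show "is_complement X {(x, v x) | x. x \<in> M}"
    using BM BX graph_is_complement unfolding is_minimal_complement_def by blast
next
  fix p assume "p \<in> {(x, v x) | x. x \<in> M}"
  then obtain w where w: "w \<in> M" "p = (w, v w)"
    by blast
  obtain y where y: "y \<notin> B + (M - {w})"
    using BM w unfolding is_minimal_complement_def by blast
  obtain C where C: "u x + v (y - x) \<le> C" for x
    using v unfolding is_moderation_def bdd_above_def by blast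
  \<comment> \<open>The height \<open>C\<close> itself is missed, because \<open>n < u a\<close> is
    strict.\<close>
  have "(y, C) \<notin> X + ({(x, v x) | x. x \<in> M} - {p})"
  proof
    assume "(y, C) \<in> X + ({(x, v x) | x. x \<in> M} - {p})"
    \<comment> \<open>A graph has only \<open>p\<close> above \<open>w\<close>, so removing
      \<open>p\<close> forces \<open>x \<noteq> w\<close>.\<close>
    then obtain a n x where *: "(a, n) \<in> X" "x \<in> M - {w}" "y = a + x" "C = n + v x"
      using w by (elim set_plus_elim) (auto, blast+)
    then have "a \<notin> B"
      using y by (auto intro: set_plus_intro)
    then have "n < u a"
      using * X by auto
    then show False
      using C[of a] * by simp
  qed
  then show "X + ({(x, v x) | x. x \<in> M} - {p}) \<noteq> UNIV"
    by blast
qed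

theorem theorem4p6:
  fixes u :: "int ^ 'k::finite \<Rightarrow> int" and B M :: "(int ^ 'k) set"
  assumes "is_minimal_complement B M"
  shows "(\<exists>v. is_moderation u v) \<and>
    (\<forall>v. is_moderation u v \<longrightarrow>
      (\<forall>X :: ((int ^ 'k) \<times> int) set.
        B \<times> UNIV \<subseteq> X \<and> X \<subseteq> (B \<times> UNIV) \<union> (\<Union>x\<in>UNIV - B. {x} \<times> {n. n < u x}) \<longrightarrow>
        is_minimal_complement X {(x, v x) | x. x \<in> M}))"
  using ex_moderation graph_is_minimal_complement[OF assms] by blast

end
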